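(* Let $X$ and $Y$ be disjoint non-empty sets and $K$ an arbitrary field. Then $\mathbb{A}_K(X)$ is an elementary subring of $\mathbb{A}_K(X\cup Y)$ if and only if $X$ is infinite.
   Context: $\mathbb{A}_K(Z)$ denotes the free associative unitary algebra over the field $K$ with free basis $Z$, viewed as a structure in the language of rings $\{+,\cdot,0,1\}$; $\mathbb{A}_K(X)$ is naturally a subring of $\mathbb{A}_K(X\cup Y)$. A substructure $A$ of $B$ is elementary if for every first-order formula $\phi(x_1,\dots,x_n)$ and all $a_1,\dots,a_n\in A$, $A\models\phi(a_1,\dots,a_n)$ iff $B\models \phi(a_1,\dots,a_n)$. *)

theory Defs
  imports Main "HOL-Library.Poly_Mapping"
begin

text \<open>Lists under concatenation are the free monoid; it is written additively because
  the convolution product of \<open>'a \<Rightarrow>\<^sub>0 'b\<close> in \<open>Poly_Mapping\<close> expects an (in general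
  non-commutative) additive monoid of exponents. With this instance \<open>'x list \<Rightarrow>\<^sub>0 'k\<close> is the
  monoid ring of the free monoid on the type \<open>'x\<close>, i.e. the ring of noncommutative polynomials.\<close>

instantiation list :: (type) monoid_add
begin

definition zero_list :: "'a list" where "0 = []"

definition plus_list :: "'a list \<Rightarrow> 'a list \<Rightarrow> 'a list" where "u + v = u @ v"

instance
  by standard (simp_all add: zero_list_def plus_list_def)

end

text \<open>The free associative unitary algebra with free basis \<open>Z\<close>: the noncommutative polynomials
  all of whose monomials are words over \<open>Z\<close>. For \<open>X \<subseteq> Z\<close> the natural embedding is inclusion.\<close>

definition free_algebra :: "'x set \<Rightarrow> ('x list \<Rightarrow>\<^sub>0 'k::field) set" where
  "free_algebra Z = {p. Poly_Mapping.keys p \<subseteq> lists Z}"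

datatype ring_term =
    Var nat
  | Zero
  | One
  | Add ring_term ring_term
  | Mul ring_term ring_term

datatype ring_formula =
    Eq ring_term ring_term
  | Neg ring_formula
  | Conj ring_formula ring_formula
  | Disj ring_formula ring_formula
  | Impl ring_formula ring_formula
  | Forall nat ring_formula
  | Exists nat ring_formula

primrec tval :: "(nat \<Rightarrow> 'a::{zero,one,plus,times}) \<Rightarrow> ring_term \<Rightarrow> 'a" where
  "tval e (Var i) = e i"
| "tval e Zero = 0"
| "tval e One = 1"
| "tval e (Add s t) = tval e s + tval e t"
| "tval e (Mul s t) = tval e s * tval e t"

text \<open>Satisfaction in the structure with universe \<open>A\<close> and the operations of the ambient type.\<close>

primrec sat :: "'a::{zero,one,plus,times} set \<Rightarrow> (nat \<Rightarrow> 'a) \<Rightarrow> ring_formula \<Rightarrow> bool" where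
  "sat A e (Eq s t) \<longleftrightarrow> tval e s = tval e t"
| "sat A e (Neg \<phi>) \<longleftrightarrow> \<not> sat A e \<phi>"
| "sat A e (Conj \<phi> \<psi>) \<longleftrightarrow> sat A e \<phi> \<and> sat A e \<psi>"
| "sat A e (Disj \<phi> \<psi>) \<longleftrightarrow> sat A e \<phi> \<or> sat A e \<psi>"
| "sat A e (Impl \<phi> \<psi>) \<longleftrightarrow> (sat A e \<phi> \<longrightarrow> sat A e \<psi>)"
| "sat A e (Forall i \<phi>) \<longleftrightarrow> (\<forall>a\<in>A. sat A (e(i := a)) \<phi>)"
| "sat A e (Exists i \<phi>) \<longleftrightarrow> (\<exists>a\<in>A. sat A (e(i := a)) \<phi>)"

definition ring_structure :: "'a::{zero,one,plus,times} set \<Rightarrow> bool" where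
  "ring_structure A \<longleftrightarrow>
     0 \<in> A \<and> 1 \<in> A \<and> (\<forall>a\<in>A. \<forall>b\<in>A. a + b \<in> A) \<and> (\<forall>a\<in>A. \<forall>b\<in>A. a * b \<in> A)"

text \<open>Parameter tuples \<open>a\<^sub>1, \<dots>, a\<^sub>n\<close> from \<open>A\<close> are given as total assignments
  \<open>nat \<Rightarrow> A\<close>; only the values at the finitely many free variables of \<open>\<phi>\<close> matter.\<close>

definition elementary_substructure :: "'a::{zero,one,plus,times} set \<Rightarrow> 'a set \<Rightarrow> bool" where
  "elementary_substructure A B \<longleftrightarrow>
     ring_structure A \<and> ring_structure B \<and> A \<subseteq> B \<and>
     (\<forall>\<phi> e. range e \<subseteq> A \<longrightarrow> (sat A e \<phi> \<longleftrightarrow> sat B e \<phi>))"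

end

theory Submission
  imports Defs "HOL-Combinatorics.Transposition"
begin

text \<open>If \<open>X\<close> is infinite, an element of \<open>\<A>\<^sub>K(X \<union> Y)\<close> can be moved into \<open>\<A>\<^sub>K(X)\<close> by an automorphism
  that permutes the letters and fixes the finitely many letters of given parameters, so the
  Tarski--Vaught criterion applies. If \<open>X = {x\<^sub>1, \<dots>, x\<^sub>n}\<close>, every element of \<open>\<A>\<^sub>K(X)\<close> has the form
  \<open>c + x\<^sub>1 q\<^sub>1 + \<dots> + x\<^sub>n q\<^sub>n\<close> with \<open>c\<close> central. In \<open>\<A>\<^sub>K(X \<union> Y)\<close> a letter \<open>y \<in> Y\<close> does not:
  comparing the coefficients of \<open>y x\<^sub>1\<close> in \<open>c x\<^sub>1 = x\<^sub>1 c\<close> shows that \<open>y\<close> does not occur in a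
  central \<open>c\<close>.\<close>

subsection \<open>Noncommutative polynomials\<close>

text \<open>Reduces identities that are additive in \<open>p\<close> to the case of a monomial. The
  set \<open>S\<close> restricts the monomials that may occur: words over given letters, words fixed
  by a transposition, or all words.\<close>

lemma poly_mapping_induct_single [consumes 1, case_names zero add]:
  fixes p :: "'a \<Rightarrow>\<^sub>0 'b::comm_monoid_add"
  assumes "Poly_Mapping.keys p \<subseteq> S" and "P 0"
    and add: "\<And>w c p. w \<in> S \<Longrightarrow> P p \<Longrightarrow> P (Poly_Mapping.single w c + p)"
  shows "P p"
  using assms(1)
proof (induction p rule: update_induct)
  case const
  then show ?case using assms(2) by simp
next
  case (update f a b)
  have eq: "Poly_Mapping.update a b f = Poly_Mapping.single a b + f"
    using update.hyps
    by (intro poly_mapping_eqI)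
      (auto simp: lookup_update lookup_add lookup_single when_def in_keys_iff)
  have "Poly_Mapping.keys (Poly_Mapping.update a b f) = insert a (Poly_Mapping.keys f)"
    using update.hyps by (simp add: keys_update)
  then show ?case
    using update.IH update.prems add[of a f b] by (simp add: eq)
qed

lemma free_algebra_single [simp]:
  "Poly_Mapping.single w (c::'k::field) \<in> free_algebra Z \<longleftrightarrow> c = 0 \<or> w \<in> lists Z"
  by (simp add: free_algebra_def)

lemma free_algebra_mono: "X \<subseteq> Z \<Longrightarrow> free_algebra X \<subseteq> free_algebra Z"
  unfolding free_algebra_def using lists_mono by blast

lemma free_algebra_add:
  "p \<in> free_algebra Z \<Longrightarrow> q \<in> free_algebra Z \<Longrightarrow> p + q \<in> free_algebra Z"
  unfolding free_algebra_def using keys_add[of p q] by blast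

lemma free_algebra_mult:
  "p \<in> free_algebra Z \<Longrightarrow> q \<in> free_algebra Z \<Longrightarrow> p * q \<in> free_algebra Z"
  unfolding free_algebra_def using keys_mult[of p q] by (fastforce simp: plus_list_def)

lemma ring_structure_free_algebra: "ring_structure (free_algebra Z)"
  unfolding ring_structure_def
  by (auto simp: free_algebra_add free_algebra_mult)
    (simp_all add: free_algebra_def zero_list_def)

definition letters :: "('x list \<Rightarrow>\<^sub>0 'k::zero) \<Rightarrow> 'x set" where
  "letters p = (\<Union>w\<in>Poly_Mapping.keys p. set w)"

lemma finite_letters: "finite (letters p)"
  by (simp add: letters_def)

lemma letters_zero [simp]: "letters 0 = {}"
  by (simp add: letters_def)

lemma free_algebra_iff_letters: "p \<in> free_algebra Z \<longleftrightarrow> letters p \<subseteq> Z"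
  by (auto simp: free_algebra_def letters_def)

subsection \<open>Satisfaction of formulas\<close>

primrec tvars :: "ring_term \<Rightarrow> nat set" where
  "tvars (Var i) = {i}"
| "tvars Zero = {}"
| "tvars One = {}"
| "tvars (Add s t) = tvars s \<union> tvars t"
| "tvars (Mul s t) = tvars s \<union> tvars t"

text \<open>Bound variables are included; all that matters is that this set is finite.\<close>

primrec vars :: "ring_formula \<Rightarrow> nat set" where
  "vars (Eq s t) = tvars s \<union> tvars t"
| "vars (Neg \<phi>) = vars \<phi>"
| "vars (Conj \<phi> \<psi>) = vars \<phi> \<union> vars \<psi>"
| "vars (Disj \<phi> \<psi>) = vars \<phi> \<union> vars \<psi>"
| "vars (Impl \<phi> \<psi>) = vars \<phi> \<union> vars \<psi>"
| "vars (Forall i \<phi>) = vars \<phi>"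
| "vars (Exists i \<phi>) = vars \<phi>"

lemma finite_tvars: "finite (tvars t)"
  by (induction t) auto

lemma finite_vars: "finite (vars \<phi>)"
  by (induction \<phi>) (auto simp: finite_tvars)

lemma tval_cong: "(\<And>i. i \<in> tvars t \<Longrightarrow> e i = e' i) \<Longrightarrow> tval e t = tval e' t"
  by (induction t) auto

lemma sat_cong: "(\<And>i. i \<in> vars \<phi> \<Longrightarrow> e i = e' i) \<Longrightarrow> sat A e \<phi> = sat A e' \<phi>"
proof (induction \<phi> arbitrary: e e')
  case (Eq s t)
  then show ?case using tval_cong[of s e e'] tval_cong[of t e e'] by auto
next
  case (Neg \<phi>)
  have "sat A e \<phi> = sat A e' \<phi>"
    by (rule Neg.IH) (simp add: Neg.prems)
  then show ?case by simp
next
  case (Conj \<phi> \<psi>)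
  have "sat A e \<phi> = sat A e' \<phi>" "sat A e \<psi> = sat A e' \<psi>"
    by (rule Conj.IH; simp add: Conj.prems)+
  then show ?case by simp
next
  case (Disj \<phi> \<psi>)
  have "sat A e \<phi> = sat A e' \<phi>" "sat A e \<psi> = sat A e' \<psi>"
    by (rule Disj.IH; simp add: Disj.prems)+
  then show ?case by simp
next
  case (Impl \<phi> \<psi>)
  have "sat A e \<phi> = sat A e' \<phi>" "sat A e \<psi> = sat A e' \<psi>"
    by (rule Impl.IH; simp add: Impl.prems)+
  then show ?case by simp
next
  case (Forall i \<phi>)
  have "sat A (e(i := a)) \<phi> = sat A (e'(i := a)) \<phi>" for a
    by (rule Forall.IH) (simp add: Forall.prems)
  then show ?case by simp
next
  case (Exists i \<phi>)
  have "sat A (e(i := a)) \<phi> = sat A (e'(i := a)) \<phi>" for a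
    by (rule Exists.IH) (simp add: Exists.prems)
  then show ?case by simp
qed

text \<open>Injectivity of \<open>h\<close> reflects equations between term values, and as
  \<open>h\<close> maps \<open>A\<close> onto \<open>A\<close>, each quantifier can be reindexed
  along \<open>h\<close>.\<close>

lemma sat_automorphism:
  fixes h :: "'a::{zero,one,plus,times} \<Rightarrow> 'a"
  assumes "inj h" and h: "h 0 = 0" "h 1 = 1" "\<And>a b. h (a + b) = h a + h b" "\<And>a b. h (a * b) = h a * h b"
    and surj: "h ` A = A"
  shows "sat A (h \<circ> e) \<phi> \<longleftrightarrow> sat A e \<phi>"
proof (induction \<phi> arbitrary: e)
  case (Eq s t)
  have "tval (h \<circ> e) u = h (tval e u)" for u
    by (induction u) (auto simp: h)
  then show ?case using \<open>inj h\<close> by (simp add: inj_eq del: o_apply)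
next
  case (Forall i \<phi>)
  have "sat A (h \<circ> e) (Forall i \<phi>) \<longleftrightarrow> (\<forall>a\<in>h ` A. sat A ((h \<circ> e)(i := a)) \<phi>)"
    by (simp only: surj sat.simps)
  also have "\<dots> \<longleftrightarrow> (\<forall>a\<in>A. sat A (h \<circ> e(i := a)) \<phi>)"
    by (simp add: fun_upd_comp)
  finally show ?case by (simp only: Forall.IH sat.simps)
next
  case (Exists i \<phi>)
  have "sat A (h \<circ> e) (Exists i \<phi>) \<longleftrightarrow> (\<exists>a\<in>h ` A. sat A ((h \<circ> e)(i := a)) \<phi>)"
    by (simp only: surj sat.simps)
  also have "\<dots> \<longleftrightarrow> (\<exists>a\<in>A. sat A (h \<circ> e(i := a)) \<phi>)"
    by (simp add: fun_upd_comp)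
  finally show ?case by (simp only: Exists.IH sat.simps)
qed auto

subsection \<open>Infinitely many letters\<close>

text \<open>\<open>map_key\<close> precomposes the coefficient function with the map on words. A
  transposition is its own inverse, so this is also the substitution exchanging \<open>a\<close> and
  \<open>b\<close> in every monomial.\<close>

definition swap_letters :: "'x \<Rightarrow> 'x \<Rightarrow> ('x list \<Rightarrow>\<^sub>0 'k::zero) \<Rightarrow> 'x list \<Rightarrow>\<^sub>0 'k" where
  "swap_letters a b = Poly_Mapping.map_key (map (transpose a b))"

context
  fixes a b :: 'x
begin

lemma map_transpose_involutory [simp]: "map (transpose a b) (map (transpose a b) w) = w"
  by (simp add: map_idI)

lemma inj_map_transpose: "inj (map (transpose a b))"
  by simp

lemma swap_letters_involutory [simp]: "swap_letters a b (swap_letters a b p) = p"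
  unfolding swap_letters_def
  by (intro poly_mapping_eqI) (simp add: map_key.rep_eq)

lemma swap_letters_add: "swap_letters a b (p + q) = swap_letters a b p + swap_letters a b q"
  unfolding swap_letters_def by (rule map_key_plus) simp

lemma swap_letters_zero [simp]: "swap_letters a b 0 = 0"
  unfolding swap_letters_def by (rule map_key_zero) simp

lemma swap_letters_single [simp]:
  "swap_letters a b (Poly_Mapping.single w c) = Poly_Mapping.single (map (transpose a b) w) c"
  unfolding swap_letters_def
  using map_key_single[OF inj_map_transpose, of "map (transpose a b) w" c]
  by (simp only: map_transpose_involutory)

lemma swap_letters_one [simp]:
  "swap_letters a b (1 :: 'x list \<Rightarrow>\<^sub>0 'k::zero_neq_one) = 1"
  by (simp add: zero_list_def flip: single_one)

text \<open>By additivity in both factors it suffices to treat two monomials, and \<open>map\<close>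
  distributes over concatenation.\<close>

lemma swap_letters_mult:
  fixes p q :: "'x list \<Rightarrow>\<^sub>0 'k::semiring_0"
  shows "swap_letters a b (p * q) = swap_letters a b p * swap_letters a b q"
proof -
  have single: "swap_letters a b (Poly_Mapping.single w c * q)
      = Poly_Mapping.single (map (transpose a b) w) c * swap_letters a b q"
    for w and c :: 'k and q
    using subset_UNIV[of "Poly_Mapping.keys q"]
    by (induction q rule: poly_mapping_induct_single)
      (simp_all add: distrib_left mult_single plus_list_def swap_letters_add)
  show ?thesis
    using subset_UNIV[of "Poly_Mapping.keys p"]
    by (induction p rule: poly_mapping_induct_single)
      (simp_all add: distrib_right swap_letters_add single)
qed

lemma inj_swap_letters: "inj (swap_letters a b)"
  by (metis injI swap_letters_involutory)

lemma letters_swap_letters: "letters (swap_letters a b p) = transpose a b ` letters p"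
proof -
  have "Poly_Mapping.keys (swap_letters a b p) = map (transpose a b) ` Poly_Mapping.keys p"
    unfolding swap_letters_def keys_map_key[OF inj_map_transpose]
    by (auto simp: image_iff simp del: map_map) (metis map_transpose_involutory)
  then show ?thesis
    by (auto simp: letters_def)
qed

lemma swap_letters_image_free_algebra:
  assumes "a \<in> Z" "b \<in> Z"
  shows "swap_letters a b ` free_algebra Z = free_algebra Z"
proof -
  have "swap_letters a b p \<in> free_algebra Z" if "p \<in> free_algebra Z" for p :: "'x list \<Rightarrow>\<^sub>0 'k::field"
  proof -
    have "transpose a b ` letters p \<subseteq> transpose a b ` Z"
      using that by (intro image_mono) (simp add: free_algebra_iff_letters)
    then show ?thesis
      using assms by (simp add: free_algebra_iff_letters letters_swap_letters)
  qed
  then show ?thesis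
    by (metis image_subsetI subset_antisym subsetI rev_image_eqI swap_letters_involutory)
qed

lemma swap_letters_id:
  fixes p :: "'x list \<Rightarrow>\<^sub>0 'k::comm_monoid_add"
  assumes "a \<notin> letters p" "b \<notin> letters p"
  shows "swap_letters a b p = p"
proof -
  have "set w \<subseteq> letters p" if "w \<in> Poly_Mapping.keys p" for w
    using that by (auto simp: letters_def)
  then have "map (transpose a b) w = w" if "w \<in> Poly_Mapping.keys p" for w
    using that assms by (intro map_idI) (metis subsetD transpose_apply_other)
  then have "Poly_Mapping.keys p \<subseteq> {w. map (transpose a b) w = w}"
    by blast
  then show ?thesis
    by (induction p rule: poly_mapping_induct_single) (simp_all add: swap_letters_add)
qed

end

section \<open>The Tarski--Vaught criterion by letter swaps\<close>

text \<open>A letter of \<open>b\<close> outside \<open>X\<close> is exchanged for a fresh letter of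
  \<open>X\<close>. This automorphism preserves satisfaction and fixes the parameters, and the
  number of letters outside \<open>X\<close> drops by one.\<close>

lemma exists_witness_over_subset:
  fixes b :: "'x list \<Rightarrow>\<^sub>0 'k::field"
  assumes "infinite X" "X \<subseteq> Z" "finite V" "V \<subseteq> X"
    and e: "\<And>j. letters (e j) \<subseteq> V"
    and "b \<in> free_algebra Z" "sat (free_algebra Z) (e(i := b)) \<phi>"
  shows "\<exists>a\<in>free_algebra X. sat (free_algebra Z) (e(i := a)) \<phi>"
  using assms(6,7)
proof (induction "card (letters b - X)" arbitrary: b)
  case 0
  then have "letters b \<subseteq> X" by (simp add: finite_letters)
  then show ?case using 0 by (auto simp: free_algebra_iff_letters)
next
  case (Suc n)
  then obtain z where z: "z \<in> letters b" "z \<notin> X"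
    by (metis Diff_eq_empty_iff card.empty nat.distinct(1) subsetI)
  \<comment> \<open>The new letter avoids \<open>V\<close>, so that parameters stay fixed, and
    avoids \<open>b\<close>, so that the swap does not bring \<open>z\<close> back.\<close>
  have "infinite (X - (V \<union> letters b))"
    using assms by (simp add: finite_letters)
  then obtain x where x: "x \<in> X" "x \<notin> V" "x \<notin> letters b"
    by (metis Diff_iff UnCI ex_in_conv finite.emptyI)
  let ?b = "swap_letters z x b"
  have zx: "z \<in> Z" "x \<in> Z" "z \<notin> V"
    using z x assms Suc.prems by (auto simp: free_algebra_iff_letters)
  have img: "swap_letters z x ` free_algebra Z = (free_algebra Z :: ('x list \<Rightarrow>\<^sub>0 'k) set)"
    using zx by (intro swap_letters_image_free_algebra)
  have "letters ?b - X = letters b - X - {z}"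
    unfolding letters_swap_letters using z x
    by (auto simp: in_transpose_image_iff) (auto simp: transpose_def split: if_splits)
  then have "n = card (letters ?b - X)"
    using Suc.hyps(2) z by (simp add: finite_letters)
  moreover have "?b \<in> free_algebra Z"
    using img Suc.prems by blast
  \<comment> \<open>Neither \<open>z\<close> nor \<open>x\<close> lies in \<open>V\<close>, so only
    the value at \<open>i\<close> moves.\<close>
  moreover have "swap_letters z x \<circ> e(i := b) = e(i := ?b)"
  proof -
    have "swap_letters z x (e j) = e j" for j
      using e[of j] zx x by (intro swap_letters_id) auto
    then show ?thesis by auto
  qed
  then have "sat (free_algebra Z) (e(i := ?b)) \<phi>"
    using sat_automorphism[OF inj_swap_letters swap_letters_zero swap_letters_one
        swap_letters_add swap_letters_mult img, of "e(i := b)" \<phi>] Suc.prems by simp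
  ultimately show ?case
    by (rule Suc.hyps(1))
qed

text \<open>Induction on the formula with \<open>V\<close> arbitrary: passing under a quantifier
  adds the letters of the chosen element to \<open>V\<close>, which stays a finite subset of
  \<open>X\<close>.\<close>

lemma sat_free_algebra_iff_of_infinite:
  fixes e :: "nat \<Rightarrow> 'x list \<Rightarrow>\<^sub>0 'k::field"
  assumes X: "infinite X" "X \<subseteq> Z" and "finite V" "V \<subseteq> X" "\<And>j. letters (e j) \<subseteq> V"
  shows "sat (free_algebra X) e \<phi> \<longleftrightarrow> sat (free_algebra Z) e \<phi>"
  using assms(3-)
proof (induction \<phi> arbitrary: V e)
  case (Neg \<phi>)
  then show ?case by (metis sat.simps(2))
next
  case (Conj \<phi> \<psi>)
  then show ?case by (metis sat.simps(3))
next
  case (Disj \<phi> \<psi>)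
  then show ?case by (metis sat.simps(4))
next
  case (Impl \<phi> \<psi>)
  then show ?case by (metis sat.simps(5))
next
  case (Forall i \<phi>)
  have step: "sat (free_algebra X) (e(i := a)) \<phi> \<longleftrightarrow> sat (free_algebra Z) (e(i := a)) \<phi>"
    if "a \<in> free_algebra X" for a
    using Forall.prems that
    by (intro Forall.IH[of "V \<union> letters a"])
      (auto simp: finite_letters free_algebra_iff_letters)
  \<comment> \<open>A counterexample to the universal formula is a witness for the negation, so it
    too can be moved into the smaller algebra.\<close>
  have "\<exists>a\<in>free_algebra X. sat (free_algebra Z) (e(i := a)) (Neg \<phi>)"
    if "b \<in> free_algebra Z" "sat (free_algebra Z) (e(i := b)) (Neg \<phi>)" for b
    using exists_witness_over_subset[OF X Forall.prems that] .
  then show ?case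
    using step free_algebra_mono[OF X(2)] by (auto simp del: fun_upd_apply)
next
  case (Exists i \<phi>)
  have step: "sat (free_algebra X) (e(i := a)) \<phi> \<longleftrightarrow> sat (free_algebra Z) (e(i := a)) \<phi>"
    if "a \<in> free_algebra X" for a
    using Exists.prems that
    by (intro Exists.IH[of "V \<union> letters a"])
      (auto simp: finite_letters free_algebra_iff_letters)
  have "\<exists>a\<in>free_algebra X. sat (free_algebra Z) (e(i := a)) \<phi>"
    if "b \<in> free_algebra Z" "sat (free_algebra Z) (e(i := b)) \<phi>" for b
    using exists_witness_over_subset[OF X Exists.prems that] .
  then show ?case
    using step free_algebra_mono[OF X(2)] by (auto simp del: fun_upd_apply)
qed simp

lemma elementary_substructure_of_infinite:
  assumes "infinite X" "X \<subseteq> Z"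
  shows "elementary_substructure (free_algebra X :: ('x list \<Rightarrow>\<^sub>0 'k::field) set) (free_algebra Z)"
proof -
  have "sat (free_algebra X) e \<phi> \<longleftrightarrow> sat (free_algebra Z) e \<phi>"
    if "range e \<subseteq> free_algebra X" for e :: "nat \<Rightarrow> 'x list \<Rightarrow>\<^sub>0 'k" and \<phi>
  proof -
    \<comment> \<open>The values of \<open>e\<close> may involve infinitely many letters in total.
      Resetting those outside \<open>vars \<phi>\<close> to \<open>0\<close> leaves finitely many
      letters.\<close>
    define e' where "e' i = (if i \<in> vars \<phi> then e i else 0)" for i
    have "sat A e \<phi> \<longleftrightarrow> sat A e' \<phi>" for A
      by (rule sat_cong) (simp add: e'_def)
    moreover have "sat (free_algebra X) e' \<phi> \<longleftrightarrow> sat (free_algebra Z) e' \<phi>"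
      using that finite_vars[of \<phi>]
      by (intro sat_free_algebra_iff_of_infinite[OF assms, of "\<Union>i\<in>vars \<phi>. letters (e i)"])
        (auto simp: e'_def finite_letters range_subsetD subset_iff free_algebra_iff_letters)
    ultimately show ?thesis by simp
  qed
  then show ?thesis
    using assms(2)
    by (simp add: elementary_substructure_def free_algebra_mono ring_structure_free_algebra)
qed

subsection \<open>Finitely many letters\<close>

definition center :: "'a::times set \<Rightarrow> 'a set" where
  "center A = {c \<in> A. \<forall>q\<in>A. c * q = q * c}"

text \<open>These are the sums \<open>x 0 * q0 + ... + c\<close> over the first \<open>k\<close>
  elements, with \<open>c\<close> central in \<open>A\<close>. Splitting off one summand at a time
  yields a first-order formula for each \<open>k\<close> by recursion.\<close>

primrec center_plus :: "'a::{plus,times} set \<Rightarrow> (nat \<Rightarrow> 'a) \<Rightarrow> nat \<Rightarrow> 'a set" where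
  "center_plus A x 0 = center A"
| "center_plus A x (Suc k) = {x k * q + r | q r. q \<in> A \<and> r \<in> A \<inter> center_plus A x k}"

text \<open>The variable \<open>0\<close> stands for the element in question, \<open>1\<close> and \<open>2\<close> are auxiliary, and
  \<open>k + 3\<close> stands for \<open>x k\<close>.\<close>

primrec center_plus_formula :: "nat \<Rightarrow> ring_formula" where
  "center_plus_formula 0 = Forall 1 (Eq (Mul (Var 0) (Var 1)) (Mul (Var 1) (Var 0)))"
| "center_plus_formula (Suc k) =
    Exists 1 (Exists 2 (Conj (Eq (Var 0) (Add (Mul (Var (k + 3)) (Var 1)) (Var 2)))
      (Exists 0 (Conj (Eq (Var 0) (Var 2)) (center_plus_formula k)))))"

text \<open>The innermost quantifier copies the remainder into variable \<open>0\<close>, so the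
  formula for \<open>k\<close> is reused without substitution. Variables from \<open>3\<close> on
  are never rebound, hence the induction hypothesis speaks of the same \<open>x\<close>.\<close>

lemma sat_center_plus_formula:
  assumes "e 0 \<in> A"
  shows "sat A e (center_plus_formula k) \<longleftrightarrow> e 0 \<in> center_plus A (\<lambda>i. e (i + 3)) k"
  using assms
proof (induction k arbitrary: e)
  case 0
  then show ?case by (simp add: center_def)
next
  case (Suc k)
  have "sat A (e(1 := q, 2 := r, 0 := r)) (center_plus_formula k)
      \<longleftrightarrow> r \<in> center_plus A (\<lambda>i. e (i + 3)) k" if "r \<in> A" for q r
  proof -
    have "(\<lambda>i. (e(1 := q, 2 := r, 0 := r)) (i + 3)) = (\<lambda>i. e (i + 3))"
      by auto
    then show ?thesis
      using Suc.IH[of "e(1 := q, 2 := r, 0 := r)"] that by (metis fun_upd_same)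
  qed
  then have "sat A e (center_plus_formula (Suc k)) \<longleftrightarrow>
      (\<exists>q\<in>A. \<exists>r\<in>A. e 0 = e (k + 3) * q + r \<and> r \<in> center_plus A (\<lambda>i. e (i + 3)) k)"
    by auto
  then show ?case by auto
qed

section \<open>Closure properties of \<open>center_plus\<close>\<close>

lemma center_plus_add:
  fixes x :: "nat \<Rightarrow> 'a::semiring"
  assumes add: "\<And>a b. a \<in> A \<Longrightarrow> b \<in> A \<Longrightarrow> a + b \<in> A"
    and "p \<in> center_plus A x k" "p' \<in> center_plus A x k"
  shows "p + p' \<in> center_plus A x k"
  using assms(2,3)
proof (induction k arbitrary: p p')
  case 0
  then show ?case by (auto simp: center_def add distrib_left distrib_right)
next
  case (Suc k)
  then obtain q r q' r' where "p = x k * q + r" "q \<in> A" "r \<in> A" "r \<in> center_plus A x k"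
    "p' = x k * q' + r'" "q' \<in> A" "r' \<in> A" "r' \<in> center_plus A x k"
    by auto
  moreover from this have "p + p' = x k * (q + q') + (r + r')"
    by (simp add: distrib_left algebra_simps)
  ultimately show ?case
    using add Suc.IH by (simp only: center_plus.simps) blast
qed

lemma center_plus_Suc_mono:
  fixes x :: "nat \<Rightarrow> 'a::semiring_0"
  assumes "0 \<in> A" "p \<in> A" "p \<in> center_plus A x k"
  shows "p \<in> center_plus A x (Suc k)"
proof -
  have "p = x k * 0 + p"
    by simp
  with assms show ?thesis
    unfolding center_plus.simps by blast
qed

lemma center_subset_center_plus:
  fixes x :: "nat \<Rightarrow> 'a::semiring_0"
  assumes "0 \<in> A" "p \<in> center A"
  shows "p \<in> center_plus A x k"
proof (induction k)
  case (Suc k)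
  then show ?case
    using assms center_plus_Suc_mono by (metis (no_types, lifting) center_def mem_Collect_eq)
qed (simp add: assms)

text \<open>The other coefficients and the central remainder are taken to be
  \<open>0\<close>.\<close>

lemma mult_in_center_plus:
  fixes x :: "nat \<Rightarrow> 'a::semiring_0"
  assumes "0 \<in> A" "i < k" "q \<in> A" "x i * q \<in> A"
  shows "x i * q \<in> center_plus A x k"
  using \<open>i < k\<close>
proof (induction k)
  case (Suc k)
  show ?case
  proof (cases "i = k")
    case True
    have "0 \<in> center_plus A x k"
      using assms by (intro center_subset_center_plus) (simp_all add: center_def)
    then show ?thesis
      using True assms by simp (metis add_0_right)
  next
    case False
    then show ?thesis
      using Suc assms center_plus_Suc_mono by (metis less_antisym)
  qed
qed simp

section \<open>Decomposition over finitely many letters\<close>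

abbreviation letter :: "'x \<Rightarrow> 'x list \<Rightarrow>\<^sub>0 'k::field" where
  "letter a \<equiv> Poly_Mapping.single [a] 1"

text \<open>A monomial is a scalar, hence central, or begins with some \<open>l i\<close>, hence is
  a right multiple of that letter. Closure under addition does the rest.\<close>

lemma free_algebra_subset_center_plus:
  fixes p :: "'x list \<Rightarrow>\<^sub>0 'k::field"
  assumes "p \<in> free_algebra (l ` {..<n})"
  shows "p \<in> center_plus (free_algebra (l ` {..<n})) (\<lambda>i. letter (l i)) n" (is "_ \<in> center_plus ?A ?x n")
proof -
  note [simp] = ring_structure_free_algebra[unfolded ring_structure_def, rule_format]
  have scalar: "Poly_Mapping.single [] c \<in> center ?A" for c :: 'k
  proof -
    \<comment> \<open>The empty word is neutral and the coefficients commute.\<close>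
    have "Poly_Mapping.single [] c * q = q * Poly_Mapping.single [] c" for q :: "'x list \<Rightarrow>\<^sub>0 'k"
      using subset_UNIV[of "Poly_Mapping.keys q"]
      by (induction q rule: poly_mapping_induct_single)
        (simp_all add: distrib_left distrib_right mult_single plus_list_def mult.commute)
    then show ?thesis by (simp add: center_def)
  qed
  have monomial: "Poly_Mapping.single w c \<in> center_plus ?A ?x n"
    if w: "w \<in> lists (l ` {..<n})" for w and c :: 'k
  proof (cases w)
    case Nil
    then show ?thesis
      using scalar by (auto intro: center_subset_center_plus)
  next
    case (Cons a u)
    then obtain i where i: "i < n" "a = l i" and u: "u \<in> lists (l ` {..<n})"
      using w Cons by auto
    have "Poly_Mapping.single w c = ?x i * Poly_Mapping.single u c"
      using Cons i by (simp add: mult_single plus_list_def)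
    moreover have "Poly_Mapping.single w c \<in> ?A" "Poly_Mapping.single u c \<in> ?A"
      using w u by simp_all
    ultimately show ?thesis
      using i mult_in_center_plus[of ?A i n "Poly_Mapping.single u c" ?x] by simp
  qed
  have "Poly_Mapping.keys p \<subseteq> lists (l ` {..<n})"
    using assms by (simp add: free_algebra_def)
  then show ?thesis
  proof (induction p rule: poly_mapping_induct_single)
    case zero
    show ?case using scalar[of 0] by (auto intro: center_subset_center_plus)
  next
    case (add w c p)
    then show ?case by (intro center_plus_add monomial) simp_all
  qed
qed

section \<open>Coefficients at a letter outside the generators\<close>

lemma lookup_letter_mult:
  assumes "y \<noteq> a"
  shows "Poly_Mapping.lookup (letter a * q) (y # w) = 0"
  using subset_UNIV[of "Poly_Mapping.keys q"]
  by (induction q rule: poly_mapping_induct_single)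
    (use assms in \<open>simp_all add: distrib_left mult_single plus_list_def lookup_add lookup_single when_def\<close>)

lemma lookup_mult_letter:
  "Poly_Mapping.lookup (q * letter a) (w @ [a]) = Poly_Mapping.lookup q w"
  using subset_UNIV[of "Poly_Mapping.keys q"]
  by (induction q rule: poly_mapping_induct_single)
    (simp_all add: distrib_right mult_single plus_list_def lookup_add lookup_single when_def)

text \<open>No word of \<open>letter (l i) * q\<close> begins with \<open>y\<close>. For central
  \<open>p\<close>, the coefficient at \<open>[y, a]\<close> is that of \<open>p\<close> at
  \<open>[y]\<close> when read in \<open>p * letter a\<close>, and \<open>0\<close> when read in
  \<open>letter a * p\<close>.\<close>

lemma lookup_center_plus:
  fixes p :: "'x list \<Rightarrow>\<^sub>0 'k::field"
  assumes "a \<in> Z" "a \<noteq> y" and "\<And>i. i < k \<Longrightarrow> l i \<noteq> y"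
    and "p \<in> center_plus (free_algebra Z) (\<lambda>i. letter (l i)) k"
  shows "Poly_Mapping.lookup p [y] = 0"
  using assms(3,4)
proof (induction k arbitrary: p)
  case 0
  then have "p * letter a = letter a * p"
    using assms by (auto simp: center_def)
  then show ?case
    using assms lookup_mult_letter[of p a "[y]"] lookup_letter_mult[of y a p "[a]"] by simp
next
  case (Suc k)
  then have "y \<noteq> l k"
    by blast
  with Suc show ?case
    by (auto simp: lookup_add lookup_letter_mult)
qed

text \<open>The separating sentence, with the letters of \<open>X\<close> as parameters, says that
  every element has the decomposition; it fails over \<open>Z\<close> at a letter outside
  \<open>X\<close>.\<close>

lemma not_elementary_substructure_of_finite:
  fixes X Z :: "'x set"
  assumes "finite X" "X \<noteq> {}" "X \<subset> Z"
  shows "\<not> elementary_substructure (free_algebra X :: ('x list \<Rightarrow>\<^sub>0 'k::field) set) (free_algebra Z)"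
proof
  let ?A = "free_algebra X :: ('x list \<Rightarrow>\<^sub>0 'k::field) set" and ?B = "free_algebra Z :: ('x list \<Rightarrow>\<^sub>0 'k) set"
  assume elem: "elementary_substructure ?A ?B"
  obtain l\<^sub>0 and n :: nat where l0: "X = l\<^sub>0 ` {..<n}"
    using finite_imp_nat_seg_image_inj_on[OF \<open>finite X\<close>] by (auto simp: lessThan_def)
  obtain a y where a: "a \<in> X" and y: "y \<in> Z" "y \<notin> X"
    using assms by blast
  \<comment> \<open>Padding the enumeration by \<open>a\<close> keeps every \<open>l i\<close> in
    \<open>X\<close>, so that the total assignment \<open>e\<close> takes values in the smaller
    algebra.\<close>
  define l where "l i = (if i < n then l\<^sub>0 i else a)" for i
  have X: "X = l ` {..<n}" and l: "l i \<in> X" for i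
    using a by (auto simp: l0 l_def)
  \<comment> \<open>The shift by \<open>3\<close> matches the variable convention of
    \<open>center_plus_formula\<close>. Below \<open>3\<close> the truncated subtraction gives the
    harmless value \<open>letter (l 0)\<close>.\<close>
  define e :: "nat \<Rightarrow> 'x list \<Rightarrow>\<^sub>0 'k" where "e i = letter (l (i - 3))" for i
  have sat_iff: "sat S (e(0 := p)) (center_plus_formula n) \<longleftrightarrow> p \<in> center_plus S (\<lambda>i. letter (l i)) n"
    if "p \<in> S" for p S
    using sat_center_plus_formula[of "e(0 := p)" S n] that by (simp add: e_def)
  have "sat ?A e (Forall 0 (center_plus_formula n))"
    using sat_iff by (simp add: free_algebra_subset_center_plus[of _ l n, folded X])
  moreover have "range e \<subseteq> ?A"
    using l by (auto simp: e_def)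
  ultimately have "sat ?B e (Forall 0 (center_plus_formula n))"
    using elem by (simp only: elementary_substructure_def)
  moreover have "letter y \<in> ?B"
    using y by simp
  ultimately have "letter y \<in> center_plus ?B (\<lambda>i. letter (l i)) n"
    using sat_iff by simp
  then have "Poly_Mapping.lookup (letter y :: 'x list \<Rightarrow>\<^sub>0 'k) [y] = 0"
    using a y l assms(3) by (intro lookup_center_plus[of a Z y n l]) auto
  then show False by simp
qed

theorem theorem7p2:
  fixes X Y :: "'x set"
  assumes "X \<inter> Y = {}" and "X \<noteq> {}" and "Y \<noteq> {}"
  shows "elementary_substructure
           (free_algebra X :: ('x list \<Rightarrow>\<^sub>0 'k::field) set) (free_algebra (X \<union> Y))
         \<longleftrightarrow> infinite X"
proof -
  have "X \<subset> X \<union> Y"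
    using assms by blast
  then show ?thesis
    using elementary_substructure_of_infinite[of X "X \<union> Y"]
      not_elementary_substructure_of_finite[of X "X \<union> Y"] assms(2) by blast
qed

end
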